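(* Let $G$ be a non-empty word-representable graph and let $k \ge 2$ be an integer. Then the $k$-th lexicographic power $G^{[k]}$ is word-representable if and only if $G$ is a comparability graph.
   Context: All graphs are simple, undirected and finite; non-empty means having at least one edge. A graph is word-representable if there is a word $w$ over its vertex set such that two distinct vertices are adjacent iff their occurrences alternate in $w$. A comparability graph is a graph admitting a transitive orientation. The lexicographic product $G_1 \circ G_2$ has vertex set $V(G_1)\times V(G_2)$, with $(u,v)$ and $(x,y)$ adjacent iff $\{u,x\}\in E(G_1)$, or $u=x$ and $\{v,y\}\in E(G_2)$. The lexicographic power is defined by $G^{[1]} = G$ and $G^{[k]} = G^{[k-1]} \circ G$ for $k \ge 2$. *)

theory Defs
  imports "Graph_Theory.Pair_Digraph"
begin

text \<open>
  Finite simple undirected graphs are the symmetric, loop-free, finite digraphs of the locale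
  \<^locale>\<open>pair_graph\<close>; an edge \<open>{u, v}\<close> is the pair of arcs \<open>(u, v)\<close> and \<open>(v, u)\<close>.
\<close>

definition alternate :: "'a list \<Rightarrow> 'a \<Rightarrow> 'a \<Rightarrow> bool" where
  "alternate w x y \<longleftrightarrow> distinct_adj (filter (\<lambda>z. z = x \<or> z = y) w)"

text \<open>
  Following the usual convention, every vertex occurs in a representing word. Without this
  requirement one gets the same class of graphs, see \<open>word_representable_iff_subset\<close> below.
\<close>

definition word_representable :: "'a pair_pre_digraph \<Rightarrow> bool" where
  "word_representable G \<longleftrightarrow>
     (\<exists>w. set w = pverts G \<and>
        (\<forall>x\<in>pverts G. \<forall>y\<in>pverts G. x \<noteq> y \<longrightarrow> ((x, y) \<in> parcs G \<longleftrightarrow> alternate w x y)))"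

definition orientation :: "'a rel \<Rightarrow> 'a pair_pre_digraph \<Rightarrow> bool" where
  "orientation F G \<longleftrightarrow>
     F \<subseteq> parcs G \<and> (\<forall>u v. (u, v) \<in> parcs G \<longrightarrow> ((u, v) \<in> F \<longleftrightarrow> (v, u) \<notin> F))"

definition comparability_graph :: "'a pair_pre_digraph \<Rightarrow> bool" where
  "comparability_graph G \<longleftrightarrow> (\<exists>F. orientation F G \<and> trans F)"

definition lex_product ::
    "'a pair_pre_digraph \<Rightarrow> 'b pair_pre_digraph \<Rightarrow> ('a \<times> 'b) pair_pre_digraph" where
  "lex_product G H =
     \<lparr> pverts = pverts G \<times> pverts H,
       parcs = {((u, v), (x, y)) | u v x y.
         (u, v) \<in> pverts G \<times> pverts H \<and> (x, y) \<in> pverts G \<times> pverts H \<and>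
         ((u, x) \<in> parcs G \<or> u = x \<and> (v, y) \<in> parcs H)} \<rparr>"

definition relabel :: "('a \<Rightarrow> 'b) \<Rightarrow> 'a pair_pre_digraph \<Rightarrow> 'b pair_pre_digraph" where
  "relabel f G = \<lparr> pverts = f ` pverts G, parcs = map_prod f f ` parcs G \<rparr>"

text \<open>
  The vertex type of an iterated product would depend on \<open>k\<close>. The iterated pair
  \<open>((v\<^sub>1, v\<^sub>2), \<dots>, v\<^sub>k)\<close> is therefore written as the list \<open>[v\<^sub>1, \<dots>, v\<^sub>k]\<close>, i.e. each product
  is transported along the injection \<open>(vs, v) \<mapsto> vs @ [v]\<close>. The value at \<open>0\<close> is a dummy.
\<close>

fun lex_power :: "'a pair_pre_digraph \<Rightarrow> nat \<Rightarrow> 'a list pair_pre_digraph" where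
  "lex_power G 0 = \<lparr> pverts = {[]}, parcs = {} \<rparr>"
| "lex_power G (Suc 0) = relabel (\<lambda>v. [v]) G"
| "lex_power G (Suc (Suc k)) =
     relabel (\<lambda>(vs, v). vs @ [v]) (lex_product (lex_power G (Suc k)) G)"

lemma pair_graph_iff:
  "pair_graph G \<longleftrightarrow> finite (pverts G) \<and> parcs G \<subseteq> pverts G \<times> pverts G \<and>
     sym (parcs G) \<and> irrefl (parcs G)"
  (is "_ \<longleftrightarrow> ?R")
proof
  assume "pair_graph G"
  then interpret pair_graph G .
  have "(u, u) \<notin> parcs G" for u
    using pair_no_loops[of "(u, u)"] by auto
  then show ?R
    using pair_finite_verts pair_sym_arcs in_arcsD1 in_arcsD2
    by (auto simp: symmetric_def irrefl_def)
next
  assume R: ?R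
  then have "finite (parcs G)"
    by (auto intro: finite_subset[of _ "pverts G \<times> pverts G"])
  with R show "pair_graph G"
    by unfold_locales (auto simp: symmetric_def irrefl_def)
qed

lemma pair_graph_lex_product:
  assumes "pair_graph G" "pair_graph H"
  shows "pair_graph (lex_product G H)"
  using assms unfolding pair_graph_iff lex_product_def sym_def irrefl_def by auto

lemma pair_graph_relabel:
  assumes "pair_graph G" "inj_on f (pverts G)"
  shows "pair_graph (relabel f G)"
proof -
  have "sym (map_prod f f ` parcs G)"
    using assms(1) unfolding pair_graph_iff sym_def by force
  moreover have "irrefl (map_prod f f ` parcs G)"
    using assms unfolding pair_graph_iff irrefl_def by (auto dest: inj_onD)
  ultimately show ?thesis
    using assms(1) unfolding pair_graph_iff relabel_def by auto
qed

lemma pair_graph_lex_power: "pair_graph G \<Longrightarrow> pair_graph (lex_power G k)"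
proof (induction G k rule: lex_power.induct)
  case (1 G)
  show ?case by (simp add: pair_graph_iff sym_def irrefl_def)
next
  case (2 G)
  then show ?case by (simp add: pair_graph_relabel inj_on_def)
next
  case (3 G k)
  have "inj_on (\<lambda>(vs, v). vs @ [v]) A" for A :: "('a list \<times> 'a) set"
    by (auto simp: inj_on_def)
  with 3 show ?case
    by (simp add: pair_graph_relabel pair_graph_lex_product)
qed

lemma pverts_lex_power: "pverts (lex_power G k) = {vs. length vs = k \<and> set vs \<subseteq> pverts G}"
proof (induction G k rule: lex_power.induct)
  case (2 G)
  show ?case by (auto simp: relabel_def length_Suc_conv)
next
  case (3 G k)
  show ?case (is "?L = ?R")
  proof (intro set_eqI iffI)
    fix vs assume "vs \<in> ?L"
    then show "vs \<in> ?R" by (auto simp: relabel_def lex_product_def 3)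
  next
    fix vs assume vs: "vs \<in> ?R"
    then obtain us u where "vs = us @ [u]" "length us = Suc k"
      by (auto simp: length_Suc_conv_rev)
    with vs have "vs = (\<lambda>(vs, v). vs @ [v]) (us, u)"
      "(us, u) \<in> pverts (lex_product (lex_power G (Suc k)) G)"
      by (auto simp: lex_product_def 3)
    from image_eqI[where f = "\<lambda>(vs, v). vs @ [v]", OF this] show "vs \<in> ?L"
      by (simp only: lex_power.simps relabel_def pair_pre_digraph.simps)
  qed
qed auto

lemma distinct_imp_adj: "distinct xs \<Longrightarrow> distinct_adj xs"
  by (induction xs rule: induct_list012) auto

lemma word_representable_iff_subset:
  assumes "finite (pverts G)"
  shows "word_representable G \<longleftrightarrow>
     (\<exists>w. set w \<subseteq> pverts G \<and>
        (\<forall>x\<in>pverts G. \<forall>y\<in>pverts G. x \<noteq> y \<longrightarrow> ((x, y) \<in> parcs G \<longleftrightarrow> alternate w x y)))"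
    (is "_ \<longleftrightarrow> ?R")
proof
  assume "word_representable G"
  then show ?R unfolding word_representable_def by blast
next
  assume ?R
  then obtain w where w: "set w \<subseteq> pverts G"
    and rep: "\<And>x y. \<lbrakk>x \<in> pverts G; y \<in> pverts G; x \<noteq> y\<rbrakk> \<Longrightarrow>
      (x, y) \<in> parcs G \<longleftrightarrow> alternate w x y"
    by blast
  obtain a where a: "set a = pverts G - set w" "distinct a"
    using assms finite_distinct_list[of "pverts G - set w"] by auto
  have same: "alternate (a @ w) x y \<longleftrightarrow> alternate w x y"
    if xy: "x \<in> pverts G" "y \<in> pverts G" "x \<noteq> y" for x y
  proof -
    let ?P = "\<lambda>z. z = x \<or> z = y"
    have adj: "distinct_adj (filter ?P a)"
      by (rule distinct_imp_adj[OF distinct_filter[OF a(2)]])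
    have "last (filter ?P a) \<noteq> hd (filter ?P w)" if "filter ?P a \<noteq> []" "filter ?P w \<noteq> []"
    proof -
      have "last (filter ?P a) \<in> set a" using last_in_set[OF that(1)] by auto
      moreover have "hd (filter ?P w) \<in> set w" using hd_in_set[OF that(2)] by auto
      ultimately show ?thesis by (metis DiffD2 a(1))
    qed
    with adj show ?thesis
      unfolding alternate_def filter_append distinct_adj_append_iff by blast
  qed
  show "word_representable G"
    unfolding word_representable_def
  proof (intro exI conjI ballI impI)
    show "set (a @ w) = pverts G" using a w by auto
  next
    fix x y assume "x \<in> pverts G" "y \<in> pverts G" "x \<noteq> y"
    then show "(x, y) \<in> parcs G \<longleftrightarrow> alternate (a @ w) x y"
      using rep same by blast
  qed
qed

end

theory Submission
  imports Defs
begin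

text \<open>
  If \<open>G\<close> is a comparability graph, then so are its lexicographic powers, and a comparability graph
  is represented by the concatenation of all linear extensions of a transitive orientation.
  Conversely, for \<open>k \<ge> 2\<close> the power \<open>G^[k]\<close> contains an induced copy of \<open>G\<close> together with a vertex \<open>x\<close>
  adjacent to all of it. In a representing word every vertex of the copy alternates with \<open>x\<close>.
  Rotating the word cyclically so that it starts with \<open>x\<close>, a vertex \<open>a\<close> precedes an adjacent
  vertex \<open>b\<close> if in every prefix \<open>a\<close> occurs as often as \<open>b\<close> or once more. The upper bound is inherited
  from the comparison with \<open>x\<close>, so this orientation is transitive.
\<close>

section \<open>Alternation expressed by prefix counts\<close>

text \<open>For distinct letters: they alternate, and \<open>a\<close> comes first if either occurs.
  In terms of counts this is a pointwise inequality that can be shifted and added.\<close>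

definition leads :: "'a list \<Rightarrow> 'a \<Rightarrow> 'a \<Rightarrow> bool" where
  "leads w a b \<longleftrightarrow>
     (\<forall>n. count_list (take n w) b \<le> count_list (take n w) a \<and>
          count_list (take n w) a \<le> Suc (count_list (take n w) b))"

lemma all_take_Cons: "(\<forall>n. P (take n (z # w))) \<longleftrightarrow> P [] \<and> (\<forall>n. P (z # take n w))"
  by (metis take0 take_Suc_Cons take_eq_Nil2 not0_implies_Suc)

text \<open>A first letter \<open>a\<close> shifts the difference of the counts by one, so the
  window from 0 to 1 becomes -1 to 0, which is \<open>leads\<close> with the roles exchanged. A
  first letter \<open>b\<close> violates the window at once.\<close>

lemma leads_Cons:
  assumes "a \<noteq> b"
  shows "leads (z # w) a b \<longleftrightarrow> z \<noteq> b \<and> (if z = a then leads w b a else leads w a b)"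
proof -
  have "leads (z # w) a b \<longleftrightarrow>
    (\<forall>n. count_list (z # take n w) b \<le> count_list (z # take n w) a \<and>
          count_list (z # take n w) a \<le> Suc (count_list (z # take n w) b))"
    unfolding leads_def
    using all_take_Cons[of "\<lambda>u. count_list u b \<le> count_list u a \<and>
      count_list u a \<le> Suc (count_list u b)" z w] by simp
  moreover have "\<exists>n. \<not> Suc (count_list (take n w) b) \<le> count_list (take n w) a"
    by (rule exI[of _ 0]) simp
  ultimately show ?thesis
    using assms by (auto simp: leads_def)
qed

text \<open>The exchange of roles in \<open>leads_Cons\<close> is why the induction keeps
  \<open>a\<close> and \<open>b\<close> arbitrary.\<close>

lemma leads_iff_alternate_hd:
  assumes "a \<noteq> b"
  shows "leads w a b \<longleftrightarrow> alternate w a b \<and>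
    (filter (\<lambda>z. z = a \<or> z = b) w = [] \<or> hd (filter (\<lambda>z. z = a \<or> z = b) w) = a)"
  using assms
proof (induction w arbitrary: a b)
  case Nil
  then show ?case by (simp add: leads_def alternate_def)
next
  case (Cons z w)
  let ?f = "filter (\<lambda>z. z = a \<or> z = b) w"
  have swap: "filter (\<lambda>z. z = b \<or> z = a) w = ?f"
    by (rule filter_cong) auto
  have "hd ?f = a \<or> hd ?f = b" if "?f \<noteq> []"
    using hd_in_set[OF that] by auto
  then show ?case
    using Cons.prems Cons.IH[OF Cons.prems] Cons.IH[OF Cons.prems[symmetric]]
    by (cases ?f) (auto simp: leads_Cons alternate_def swap)
qed

lemma alternate_iff_leads:
  assumes "a \<noteq> b"
  shows "alternate w a b \<longleftrightarrow> leads w a b \<or> leads w b a"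
proof -
  let ?f = "filter (\<lambda>z. z = a \<or> z = b) w"
  have swap: "filter (\<lambda>z. z = b \<or> z = a) w = ?f"
    by (rule filter_cong) auto
  have "hd ?f = a \<or> hd ?f = b" if "?f \<noteq> []"
    using hd_in_set[OF that] by auto
  then show ?thesis
    using leads_iff_alternate_hd[OF assms, of w] leads_iff_alternate_hd[OF assms[symmetric], of w]
    by (auto simp: alternate_def swap)
qed

text \<open>Otherwise the restriction of \<open>w\<close> to the two letters would be non-empty and
  start with both.\<close>

lemma leads_antisym:
  assumes "a \<noteq> b" "leads w a b" "leads w b a"
  shows "a \<notin> set w"
proof
  assume "a \<in> set w"
  then have "filter (\<lambda>z. z = a \<or> z = b) w \<noteq> []" "filter (\<lambda>z. z = b \<or> z = a) w \<noteq> []"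
    by (auto simp: filter_empty_conv)
  moreover have "filter (\<lambda>z. z = b \<or> z = a) w = filter (\<lambda>z. z = a \<or> z = b) w"
    by (rule filter_cong) auto
  ultimately show False
    using assms leads_iff_alternate_hd[of a b w] leads_iff_alternate_hd[of b a w] by auto
qed

section \<open>Neighbourhoods in word-representable graphs\<close>

text \<open>The known fact that neighbourhoods in word-representable graphs induce comparability
  graphs, phrased via an embedding \<open>f\<close> of \<open>G\<close> into the neighbourhood of
  \<open>x\<close>.\<close>

lemma comparability_graph_if_dominating_vertex:
  assumes G: "pair_graph G"
    and H: "word_representable H"
    and x: "x \<in> pverts H"
    and f: "inj_on f (pverts G)" "f ` pverts G \<subseteq> pverts H"
    and arcs: "\<And>a b. \<lbrakk>a \<in> pverts G; b \<in> pverts G\<rbrakk> \<Longrightarrow> (f a, f b) \<in> parcs H \<longleftrightarrow> (a, b) \<in> parcs G"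
    and dom: "\<And>a. a \<in> pverts G \<Longrightarrow> x \<noteq> f a \<and> (x, f a) \<in> parcs H"
  shows "comparability_graph G"
proof -
  obtain w where w: "set w = pverts H"
    and rep: "\<And>u v. \<lbrakk>u \<in> pverts H; v \<in> pverts H; u \<noteq> v\<rbrakk> \<Longrightarrow> (u, v) \<in> parcs H \<longleftrightarrow> alternate w u v"
    using H unfolding word_representable_def by blast
  have vG: "a \<in> pverts G \<and> b \<in> pverts G \<and> a \<noteq> b" if "(a, b) \<in> parcs G" for a b
    using G that unfolding pair_graph_iff irrefl_def by auto
  have symG: "(b, a) \<in> parcs G" if "(a, b) \<in> parcs G" for a b
    using G that unfolding pair_graph_iff sym_def by auto
  define N where "N u n = int (count_list (take n w) u)" for u n
  have leadsN: "leads w u v \<longleftrightarrow> (\<forall>n. 0 \<le> N u n - N v n \<and> N u n - N v n \<le> 1)" for u v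
    unfolding leads_def N_def by (intro all_cong1) linarith
  have N0: "N u 0 = 0" for u
    by (simp add: N_def)
  \<comment> \<open>Occurrence counts after rotating the word: vertices that precede \<open>x\<close> lose one occurrence.\<close>
  define g where "g a n = N (f a) n - (if leads w x (f a) then 0 else 1)" for a n
  have alt: "alternate w (f a) (f b) \<longleftrightarrow> (a, b) \<in> parcs G"
    if "a \<in> pverts G" "b \<in> pverts G" "a \<noteq> b" for a b
    using rep[of "f a" "f b"] arcs[of a b] f that by (auto dest: inj_onD)
  have x_alt: "leads w x (f a) \<or> leads w (f a) x" if "a \<in> pverts G" for a
  proof -
    have "alternate w x (f a)"
      using rep[of x "f a"] dom[OF that] x f that by auto
    then show ?thesis
      using dom[OF that] alternate_iff_leads[of x "f a"] by blast
  qed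
  \<comment> \<open>The shift puts all vertices of the copy into one window, from
    \<open>N x n - 1\<close> to \<open>N x n\<close>.\<close>
  have gx: "0 \<le> N x n - g a n \<and> N x n - g a n \<le> 1" if "a \<in> pverts G" for a n
  proof (cases "leads w x (f a)")
    case True
    then show ?thesis
      by (simp add: g_def leadsN)
  next
    case False
    then have "leads w (f a) x"
      using x_alt[OF that] by blast
    then have "0 \<le> N (f a) n - N x n \<and> N (f a) n - N x n \<le> 1"
      unfolding leadsN by blast
    with False show ?thesis
      by (simp add: g_def)
  qed
  \<comment> \<open>The counterpart of \<open>leads\<close> for the rotated word.\<close>
  define R where "R a b \<longleftrightarrow> (\<forall>n. 0 \<le> g a n - g b n \<and> g a n - g b n \<le> 1)" for a b
  have g0: "g a 0 = (if leads w x (f a) then 0 else - 1)" for a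
    by (simp add: g_def N0)
  have adj_if_R: "(a, b) \<in> parcs G" if ab: "a \<in> pverts G" "b \<in> pverts G" "a \<noteq> b" and R: "R a b" for a b
  proof -
    \<comment> \<open>At the empty prefix \<open>g\<close> is 0 or -1, so \<open>R a b\<close>
      excludes that \<open>f a\<close> is shifted while \<open>f b\<close> is not.\<close>
    have "0 \<le> g a 0 - g b 0"
      using R unfolding R_def by blast
    then consider "leads w x (f a) \<longleftrightarrow> leads w x (f b)"
      | "leads w x (f a)" "\<not> leads w x (f b)"
      unfolding g0 by (auto split: if_splits)
    then have "leads w (f a) (f b) \<or> leads w (f b) (f a)"
    proof cases
      case 1
      then have "g a n - g b n = N (f a) n - N (f b) n" for n
        by (simp add: g_def)
      then show ?thesis
        using R by (simp add: R_def leadsN)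
    next
      \<comment> \<open>With only \<open>f b\<close> shifted, the window for the original counts is
        -1 to 0, so \<open>f b\<close> leads.\<close>
      case 2
      then have "g a n - g b n = N (f a) n - N (f b) n + 1" for n
        by (simp add: g_def)
      then have "0 \<le> N (f b) n - N (f a) n \<and> N (f b) n - N (f a) n \<le> 1" for n
        using R unfolding R_def by (smt (verit))
      then show ?thesis
        by (simp add: leadsN)
    qed
    then show ?thesis
      using alt[OF ab] alternate_iff_leads f ab by (metis inj_onD)
  qed
  have R_if_leads: "R a b \<or> R b a"
    if ab: "a \<in> pverts G" "b \<in> pverts G" and lead: "leads w (f a) (f b)" for a b
  proof -
    have lead': "0 \<le> N (f a) n - N (f b) n \<and> N (f a) n - N (f b) n \<le> 1" for n
      using lead unfolding leadsN by blast
    consider "leads w x (f a) \<longleftrightarrow> leads w x (f b)"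
      | "\<not> leads w x (f a)" "leads w x (f b)"
      | "leads w x (f a)" "\<not> leads w x (f b)"
      by blast
    then show ?thesis
    proof cases
      case 1
      then have "g a n - g b n = N (f a) n - N (f b) n" for n
        by (simp add: g_def)
      then show ?thesis
        using lead' by (simp add: R_def)
    next
      case 2
      then have "g b n - g a n = 1 - (N (f a) n - N (f b) n)" for n
        by (simp add: g_def)
      then show ?thesis
        using lead' by (simp add: R_def)
    next
      \<comment> \<open>Impossible: the counts of \<open>x\<close>, \<open>f a\<close>,
        \<open>f b\<close>, \<open>x\<close> are weakly decreasing in this order, hence equal, so
        \<open>x\<close> and \<open>f a\<close> lead each other although \<open>x\<close> occurs in
        \<open>w\<close>.\<close>
      case 3
      then have "leads w (f b) x"
        using x_alt[OF ab(2)] by blast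
      then have "N x n = N (f a) n" for n
        using lead 3(1) unfolding leadsN by (smt (verit))
      then have "leads w (f a) x"
        by (simp add: leadsN)
      then show ?thesis
        using leads_antisym[OF _ 3(1)] dom[OF ab(1)] x w by blast
    qed
  qed
  have R_total: "R a b \<or> R b a" if "(a, b) \<in> parcs G" for a b
  proof -
    have "f a \<noteq> f b"
      using vG[OF that] f(1) by (auto dest: inj_onD)
    then have "leads w (f a) (f b) \<or> leads w (f b) (f a)"
      using alt[of a b] vG[OF that] that alternate_iff_leads by metis
    then show ?thesis
      using R_if_leads vG[OF that] by blast
  qed
  have R_antisym: "\<not> R b a" if "(a, b) \<in> parcs G" "R a b" for a b
  proof
    assume "R b a"
    with that(2) have eq: "g a n = g b n" for n
      unfolding R_def by (meson antisym_conv diff_ge_0_iff_ge)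
    \<comment> \<open>Equality at the empty prefix means equal shifts, so the original counts agree
      as well.\<close>
    from eq[of 0] have "leads w x (f a) \<longleftrightarrow> leads w x (f b)"
      unfolding g0 by (auto split: if_splits)
    with eq have "N (f a) n = N (f b) n" for n
      unfolding g_def by (simp split: if_splits)
    then have "leads w (f a) (f b)" "leads w (f b) (f a)"
      unfolding leadsN by auto
    moreover have "f a \<noteq> f b" "f a \<in> set w"
      using vG[OF that(1)] f w by (auto dest: inj_onD)
    ultimately show False
      using leads_antisym[of "f a" "f b" w] by simp
  qed
  have R_trans: "R a c" if "a \<in> pverts G" "c \<in> pverts G" "R a b" "R b c" for a b c
    unfolding R_def
  proof
    fix n
    have "0 \<le> g a n - g b n" "0 \<le> g b n - g c n"
      using that(3,4) unfolding R_def by blast+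
    \<comment> \<open>Adding the upper bounds would only give 2; the common window \<open>gx\<close>
      gives 1.\<close>
    then show "0 \<le> g a n - g c n \<and> g a n - g c n \<le> 1"
      using gx[OF that(1), of n] gx[OF that(2), of n] by linarith
  qed
  define F where "F = {(a, b) \<in> parcs G. R a b}"
  have "orientation F G"
    using R_total R_antisym symG unfolding orientation_def F_def by blast
  moreover have "trans F"
  proof (rule transI)
    fix a b c assume "(a, b) \<in> F" "(b, c) \<in> F"
    then have ab: "(a, b) \<in> parcs G" "R a b" and bc: "(b, c) \<in> parcs G" "R b c"
      unfolding F_def by auto
    then have "R a c" "a \<noteq> c"
      using R_trans[of a c b] R_antisym[OF ab] vG[OF ab(1)] vG[OF bc(1)] by auto
    then show "(a, c) \<in> F"
      \<comment> \<open>For distinct vertices \<open>R\<close> forces their copies to alternate, so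
        the pair is an edge.\<close>
      using adj_if_R[of a c] vG[OF ab(1)] vG[OF bc(1)] by (simp add: F_def)
  qed
  ultimately show ?thesis
    unfolding comparability_graph_def by blast
qed

section \<open>Comparability graphs are word-representable\<close>

text \<open>Sorting by the number of predecessors yields a linear extension.\<close>

lemma linear_extension_exists:
  assumes "finite V" "F \<subseteq> V \<times> V" "trans F" "irrefl F"
  obtains p where "distinct p" "set p = V"
    "\<And>u v. (u, v) \<in> F \<Longrightarrow> filter (\<lambda>z. z = u \<or> z = v) p = [u, v]"
proof -
  obtain q where q: "set q = V" "distinct q"
    using finite_distinct_list[OF assms(1)] by blast
  define r where "r v = card {u. (u, v) \<in> F}" for v
  define p where "p = sort_key r q"
  have p: "distinct p" "set p = V" "sorted (map r p)"
    using q by (auto simp: p_def)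
  show thesis
  proof (rule that[OF p(1,2)])
    fix u v assume uv: "(u, v) \<in> F"
    \<comment> \<open>Transitivity gives the inclusion; it is strict because \<open>u\<close> lies
      only in the right-hand set.\<close>
    have "{t. (t, u) \<in> F} \<subset> {t. (t, v) \<in> F}"
      using uv assms(3,4) unfolding trans_def irrefl_def by blast
    moreover have "finite {t. (t, v) \<in> F}"
      using assms(1,2) by (auto intro: finite_subset)
    ultimately have lt: "r u < r v"
      unfolding r_def by (rule psubset_card_mono[rotated])
    let ?l = "filter (\<lambda>z. z = u \<or> z = v) p"
    have l: "distinct ?l" "set ?l = {u, v}" "sorted (map r ?l)"
      using p uv assms(2) by (auto intro: sorted_filter)
    moreover have "length ?l = 2"
      using distinct_card[OF l(1)] lt unfolding l(2) by (cases "u = v") auto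
    then obtain s t where "?l = [s, t]"
      by (auto simp: length_Suc_conv numeral_2_eq_2)
    ultimately show "?l = [u, v]"
      using lt by (auto simp: doubleton_eq_iff)
  qed
qed

text \<open>Applied in both directions to a non-adjacent pair, this yields two linear extensions
  that disagree on it, which destroys alternation.\<close>

lemma linear_extension_exists_ordering:
  assumes "finite V" "F \<subseteq> V \<times> V" "trans F" "irrefl F"
    and xy: "x \<in> V" "y \<in> V" "x \<noteq> y" "(y, x) \<notin> F"
  obtains p where "distinct p" "set p = V"
    "\<And>u v. (u, v) \<in> F \<Longrightarrow> filter (\<lambda>z. z = u \<or> z = v) p = [u, v]"
    "filter (\<lambda>z. z = x \<or> z = y) p = [x, y]"
proof -
  \<comment> \<open>Everything at or below \<open>x\<close> is put below everything at or above
    \<open>y\<close>. A cycle would give \<open>y = x\<close> or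
    \<open>(y, x) \<in> F\<close>.\<close>
  define F' where "F' = F \<union> {(a, b). (a = x \<or> (a, x) \<in> F) \<and> (b = y \<or> (y, b) \<in> F)}"
  have "F' \<subseteq> V \<times> V"
    using assms(2) xy unfolding F'_def by auto
  moreover have "trans F'"
    using assms(3) xy unfolding F'_def trans_def by blast
  moreover have "irrefl F'"
    using assms(3,4) xy unfolding F'_def trans_def irrefl_def by blast
  ultimately obtain p where "distinct p" "set p = V"
    "\<And>u v. (u, v) \<in> F' \<Longrightarrow> filter (\<lambda>z. z = u \<or> z = v) p = [u, v]"
    using linear_extension_exists[OF assms(1)] by metis
  moreover have "F \<subseteq> F'" "(x, y) \<in> F'"
    unfolding F'_def by auto
  ultimately show thesis
    using that by blast
qed

text \<open>Two equal letters meet exactly at a border between different blocks.\<close>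

lemma distinct_adj_concat_pairs:
  assumes "u \<noteq> v" "set qs \<subseteq> {[u, v], [v, u]}"
  shows "distinct_adj (concat qs) \<longleftrightarrow> (\<forall>q\<in>set qs. \<forall>q'\<in>set qs. q = q')"
  using assms(2)
proof (induction qs rule: induct_list012)
  case (3 q r qs)
  then have "distinct_adj (concat (q # r # qs)) \<longleftrightarrow> q = r \<and> distinct_adj (concat (r # qs))"
    using assms(1) by auto
  with 3 show ?case by auto
qed (use assms(1) in auto)

lemma word_representable_if_comparability_graph:
  assumes G: "pair_graph G" and "comparability_graph G"
  shows "word_representable G"
proof -
  obtain F where F: "orientation F G" "trans F"
    using assms(2) unfolding comparability_graph_def by blast
  let ?V = "pverts G"
  have V: "finite ?V" "F \<subseteq> ?V \<times> ?V"
    using G F(1) unfolding pair_graph_iff orientation_def by auto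
  have irr: "irrefl F"
    using F(1) unfolding orientation_def irrefl_def by blast
  note FV = V F(2) irr
  define S where "S = {p. distinct p \<and> set p = ?V \<and>
    (\<forall>u v. (u, v) \<in> F \<longrightarrow> filter (\<lambda>z. z = u \<or> z = v) p = [u, v])}"
  have "finite S"
    by (rule finite_subset[OF _ finite_subset_distinct[OF V(1)]]) (auto simp: S_def)
  then obtain ps where ps: "set ps = S"
    using finite_list by blast
  \<comment> \<open>\<open>S\<close> is non-empty, so every vertex occurs in the concatenated
    word.\<close>
  obtain p where "p \<in> S"
    by (rule linear_extension_exists[OF FV]) (unfold S_def, blast)
  then have "set (concat ps) = ?V"
    using ps by (auto simp: S_def)
  moreover have "(x, y) \<in> parcs G \<longleftrightarrow> alternate (concat ps) x y"
    if xy: "x \<in> ?V" "y \<in> ?V" "x \<noteq> y" for x y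
  proof -
    \<comment> \<open>Restricted to \<open>x\<close> and \<open>y\<close>, each extension
      contributes one block, \<open>[x, y]\<close> or \<open>[y, x]\<close>.\<close>
    define h where "h = filter (\<lambda>z. z = x \<or> z = y)"
    have h_yx: "h = filter (\<lambda>z. z = y \<or> z = x)"
      unfolding h_def by (rule arg_cong[where f = filter]) auto
    have h_cases: "h p \<in> {[x, y], [y, x]}" if "p \<in> S" for p
    proof -
      have "distinct (h p)" "set (h p) = {x, y}"
        using that xy by (auto simp: S_def h_def)
      moreover from this have "length (h p) = 2"
        using distinct_card[of "h p"] xy(3) by auto
      then obtain s t where "h p = [s, t]"
        by (auto simp: length_Suc_conv numeral_2_eq_2)
      ultimately show ?thesis
        by (auto simp: doubleton_eq_iff)
    qed
    have "alternate (concat ps) x y \<longleftrightarrow> distinct_adj (concat (map h ps))"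
      by (simp add: alternate_def h_def filter_concat)
    also have "\<dots> \<longleftrightarrow> (\<forall>p\<in>S. \<forall>q\<in>S. h p = h q)"
      using distinct_adj_concat_pairs[OF xy(3), of "map h ps"] h_cases ps by auto
    also have "\<dots> \<longleftrightarrow> (x, y) \<in> parcs G"
    proof
      assume "(x, y) \<in> parcs G"
      then consider "(x, y) \<in> F" | "(y, x) \<in> F"
        using F(1) unfolding orientation_def by blast
      then show "\<forall>p\<in>S. \<forall>q\<in>S. h p = h q"
      proof cases
        case 1
        then show ?thesis by (simp add: S_def h_def)
      next
        case 2
        then show ?thesis by (simp add: S_def h_yx)
      qed
    next
      assume same: "\<forall>p\<in>S. \<forall>q\<in>S. h p = h q"
      show "(x, y) \<in> parcs G"
      proof (rule ccontr)
        assume "(x, y) \<notin> parcs G"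
        then have nF: "(x, y) \<notin> F" "(y, x) \<notin> F"
          using F(1) G unfolding orientation_def pair_graph_iff sym_def by blast+
        obtain p where "p \<in> S" "h p = [x, y]"
          by (rule linear_extension_exists_ordering[OF FV xy nF(2)]) (unfold S_def h_def, blast)
        moreover obtain q where "q \<in> S" "h q = [y, x]"
          by (rule linear_extension_exists_ordering[OF FV xy(2,1) xy(3)[symmetric] nF(1)])
            (unfold S_def h_yx, blast)
        ultimately show False
          using same xy(3) by fastforce
      qed
    qed
    finally show ?thesis by blast
  qed
  ultimately show ?thesis
    unfolding word_representable_def by blast
qed

section \<open>Lexicographic powers\<close>

lemma comparability_graph_lex_product:
  assumes "pair_graph G" "pair_graph H" "comparability_graph G" "comparability_graph H"
  shows "comparability_graph (lex_product G H)"
proof -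
  obtain A B where A: "orientation A G" "trans A" and B: "orientation B H" "trans B"
    using assms(3,4) unfolding comparability_graph_def by blast
  \<comment> \<open>The lexicographic combination: \<open>A\<close> decides, and \<open>B\<close>
    only within a fibre.\<close>
  define F where "F = {((u, v), (x, y)) | u v x y.
    (u, v) \<in> pverts G \<times> pverts H \<and> (x, y) \<in> pverts G \<times> pverts H \<and>
    ((u, x) \<in> A \<or> u = x \<and> (v, y) \<in> B)}"
  \<comment> \<open>Without loops in \<open>G\<close>, an arc with equal first coordinates must come
    from \<open>H\<close>.\<close>
  have "(u, u) \<notin> parcs G" for u
    using assms(1) unfolding pair_graph_iff irrefl_def by blast
  then have "orientation F (lex_product G H)"
    using A(1) B(1) unfolding orientation_def lex_product_def F_def by auto
  moreover have "trans F"
    using A(2) B(2) unfolding trans_def F_def by blast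
  ultimately show ?thesis
    unfolding comparability_graph_def by blast
qed

lemma comparability_graph_relabel:
  assumes "pair_graph G" "inj_on f (pverts G)" "comparability_graph G"
  shows "comparability_graph (relabel f G)"
proof -
  obtain A where A: "orientation A G" "trans A"
    using assms(3) unfolding comparability_graph_def by blast
  have A_sub: "A \<subseteq> pverts G \<times> pverts G" and G_sub: "parcs G \<subseteq> pverts G \<times> pverts G"
    using A(1) assms(1) unfolding orientation_def pair_graph_iff by auto
  have f_iff: "(f a, f b) \<in> map_prod f f ` E \<longleftrightarrow> (a, b) \<in> E"
    if "a \<in> pverts G" "b \<in> pverts G" "E \<subseteq> pverts G \<times> pverts G" for a b E
  proof
    assume "(f a, f b) \<in> map_prod f f ` E"
    then obtain c d where cd: "(c, d) \<in> E" "f a = f c" "f b = f d"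
      by auto
    with that have "a = c" "b = d"
      using assms(2) by (auto dest: inj_onD)
    with cd(1) show "(a, b) \<in> E" by simp
  qed auto
  have "orientation (map_prod f f ` A) (relabel f G)"
    unfolding orientation_def
  proof (intro conjI allI impI)
    show "map_prod f f ` A \<subseteq> parcs (relabel f G)"
      using A(1) unfolding orientation_def relabel_def by auto
  next
    fix u v assume "(u, v) \<in> parcs (relabel f G)"
    then obtain a b where ab: "(a, b) \<in> parcs G" "u = f a" "v = f b"
      by (auto simp: relabel_def)
    then have "a \<in> pverts G" "b \<in> pverts G"
      using G_sub by auto
    then show "(u, v) \<in> map_prod f f ` A \<longleftrightarrow> (v, u) \<notin> map_prod f f ` A"
      using ab f_iff[OF _ _ A_sub] A(1) unfolding orientation_def by simp
  qed
  moreover have "trans (map_prod f f ` A)"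
  proof (rule transI)
    fix u v w assume "(u, v) \<in> map_prod f f ` A" "(v, w) \<in> map_prod f f ` A"
    then obtain a b b' c where
      "(a, b) \<in> A" "(b', c) \<in> A" "u = f a" "f b = f b'" "w = f c"
      by auto
    moreover from this have "b = b'"
      using A_sub by (intro inj_onD[OF assms(2)]) auto
    ultimately show "(u, w) \<in> map_prod f f ` A"
      using transD[OF A(2), of a b c] by (metis map_prod_imageI)
  qed
  ultimately show ?thesis
    unfolding comparability_graph_def by blast
qed

lemma inj_on_snoc: "inj_on (\<lambda>(vs, v). vs @ [v]) A"
  by (auto simp: inj_on_def)

lemma comparability_graph_lex_power:
  assumes "pair_graph G" "comparability_graph G"
  shows "comparability_graph (lex_power G (Suc k))"
proof (induction k)
  case 0
  show ?case
    using assms by (simp add: comparability_graph_relabel inj_on_def)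
next
  case (Suc k)
  then show ?case
    using assms pair_graph_lex_power[OF assms(1), of "Suc k"]
    by (simp add: comparability_graph_relabel comparability_graph_lex_product
        pair_graph_lex_product inj_on_snoc)
qed

lemma parcs_lex_power_Suc:
  "(us @ [a], vs @ [b]) \<in> parcs (lex_power G (Suc (Suc k))) \<longleftrightarrow>
     us \<in> pverts (lex_power G (Suc k)) \<and> vs \<in> pverts (lex_power G (Suc k)) \<and>
     a \<in> pverts G \<and> b \<in> pverts G \<and>
     ((us, vs) \<in> parcs (lex_power G (Suc k)) \<or> us = vs \<and> (a, b) \<in> parcs G)"
  by (force simp: relabel_def lex_product_def image_iff)

text \<open>An arc lifts to the next power by appending the same vertex to both ends. This supplies
  the adjacent prefixes used below.\<close>

lemma parcs_lex_power_nonempty: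
  assumes "pair_graph G" "parcs G \<noteq> {}"
  shows "parcs (lex_power G (Suc k)) \<noteq> {}"
proof (induction k)
  case 0
  show ?case using assms(2) by (simp add: relabel_def)
next
  case (Suc k)
  obtain us vs where "(us, vs) \<in> parcs (lex_power G (Suc k))"
    using Suc by auto
  moreover obtain a where "a \<in> pverts G"
    using assms unfolding pair_graph_iff by auto
  ultimately have "(us @ [a], vs @ [a]) \<in> parcs (lex_power G (Suc (Suc k)))"
    using pair_graph_lex_power[OF assms(1), of "Suc k"]
    unfolding parcs_lex_power_Suc pair_graph_iff by blast
  then show ?case by blast
qed

text \<open>For an arc \<open>(us, vs)\<close> of the preceding power, the fibre over
  \<open>vs\<close> is an induced copy of \<open>G\<close>, and any vertex of the fibre over
  \<open>us\<close> is adjacent to all of it.\<close>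

lemma comparability_graph_if_word_representable_lex_power:
  assumes G: "pair_graph G" "parcs G \<noteq> {}"
    and rep: "word_representable (lex_power G (Suc (Suc k)))"
  shows "comparability_graph G"
proof -
  obtain us vs where e: "(us, vs) \<in> parcs (lex_power G (Suc k))"
    using parcs_lex_power_nonempty[OF G, of k] by auto
  have P: "us \<in> pverts (lex_power G (Suc k))" "vs \<in> pverts (lex_power G (Suc k))"
    "us \<noteq> vs" "(vs, vs) \<notin> parcs (lex_power G (Suc k))"
    using e pair_graph_lex_power[OF G(1), of "Suc k"] unfolding pair_graph_iff irrefl_def by auto
  obtain g where g: "g \<in> pverts G"
    using G unfolding pair_graph_iff by auto
  show ?thesis
  proof (rule comparability_graph_if_dominating_vertex[OF G(1) rep,
        where x = "us @ [g]" and f = "\<lambda>a. vs @ [a]"])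
    show "us @ [g] \<in> pverts (lex_power G (Suc (Suc k)))"
      "(\<lambda>a. vs @ [a]) ` pverts G \<subseteq> pverts (lex_power G (Suc (Suc k)))"
      using P g by (auto simp: pverts_lex_power simp del: lex_power.simps)
  qed (use P g e in \<open>auto simp: parcs_lex_power_Suc inj_on_def simp del: lex_power.simps\<close>)
qed

theorem theorem9:
  fixes G :: "'a pair_pre_digraph" and k :: nat
  assumes "pair_graph G"
    and "parcs G \<noteq> {}"
    and "word_representable G"
    and "k \<ge> 2"
  shows "word_representable (lex_power G k) \<longleftrightarrow> comparability_graph G"
proof -
  obtain m where k: "k = Suc (Suc m)"
    using assms(4) by (metis Suc_le_D numeral_2_eq_2 Suc_le_mono)
  show ?thesis
    using comparability_graph_if_word_representable_lex_power[OF assms(1,2)]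
      word_representable_if_comparability_graph[OF pair_graph_lex_power[OF assms(1)]]
      comparability_graph_lex_power[OF assms(1)]
    unfolding k by blast
qed

end
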